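(* Let $N\ge1$, assume $\mathcal{U}_N\neq\mathbb{Z}_{\geq2}$, and let $x_{\mathrm{miss}}:=\min\{x\geq2:x\notin\mathcal{U}_N\}$. Then $$x_{\mathrm{miss}}\leq2^{\sigma_N}+1\qquad\text{and}\qquad K(N)=x_{\mathrm{miss}}-1.$$ Testing membership in $\mathcal{U}_N$ reduces to the finite interval $[2,2^{\sigma_N}+1]$: an integer $x\ge2$ lies in $\mathcal{U}_N$ if and only if the unique integer in $[2,2^{\sigma_N}+1]$ congruent to $x$ modulo $2^{\sigma_N}$ lies in $\mathcal{U}_N$.
   Context: Let $\kappa(n)=\lfloor n\log_2 3\rfloor$ for $n\ge1$ and $\sigma_n=\lfloor 1+(n+1)\log_2 3\rfloor=\kappa(n+1)+1$. For $n\ge1$ let $\mathcal{A}_n$ be the set of integer vectors $\boldsymbol{\alpha}=(\alpha_1,\ldots,\alpha_{n+1})$ with $0=\alpha_1<\cdots<\alpha_{n+1}$ and $\alpha_{i+1}\le\kappa(i)$ for $1\le i\le n$. Let $T:\mathbb{Z}\to\mathbb{Z}$ be $T(x)=x/2$ for even $x$ and $T(x)=(3x+1)/2$ for odd $x$. The parity vector of length $L$ of an integer $x$ has entry $1$ at position $s$ ($0\le s\le L-1$) iff $T^s(x)$ is odd; it depends only on $x$ mod $2^L$ and gives a bijection $\mathbb{Z}/2^L\mathbb{Z}\to\{0,1\}^L$. For $\boldsymbol{\alpha}\in\mathcal{A}_n$ let $c(\boldsymbol{\alpha})$ be the unique element of $\{1,\ldots,2^{\sigma_n}-1\}$ whose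 parity vector of length $\sigma_n$ has ones precisely at positions $\alpha_1,\ldots,\alpha_{n+1}$; put $\mathcal{C}_n=\{c(\boldsymbol{\alpha}):\boldsymbol{\alpha}\in\mathcal{A}_n\}$. For $N\ge1$ the coverage set of order $N$ is the set $\mathcal{U}_N$ of all integers $x\ge2$ such that $x\equiv0\pmod2$, or $x\equiv1\pmod4$, or $x\equiv a\pmod{2^{\sigma_n}}$ for some $1\le n\le N$ and some $a\in\mathcal{C}_n$. The coverage bound is $K(N)=\max\{K\ge2:\{2,3,\ldots,K\}\subseteq\mathcal{U}_N\}$, with $K(N)=\infty$ if $\mathcal{U}_N=\mathbb{Z}_{\ge2}$. *)

theory Defs
  imports Complex_Main "HOL-Number_Theory.Cong" "HOL-Library.Extended_Nat"
begin

definition kappa :: "nat \<Rightarrow> nat" where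
  "kappa n = nat \<lfloor>real n * log 2 3\<rfloor>"

definition sigma :: "nat \<Rightarrow> nat" where
  "sigma n = nat \<lfloor>1 + real (n + 1) * log 2 3\<rfloor>"

(* The vector (alpha_1, ..., alpha_(n+1)) is the list [alpha_1, ..., alpha_(n+1)], so
   alpha_(i+1) is as ! i.  Natural-number entries lose nothing, because alpha_1 = 0
   and the entries increase. *)
definition admissible :: "nat \<Rightarrow> nat list set" where
  "admissible n = {as. length as = n + 1 \<and> as ! 0 = 0 \<and> sorted_wrt (<) as \<and>
     (\<forall>i\<in>{1..n}. as ! i \<le> kappa i)}"

definition collatz :: "int \<Rightarrow> int" where
  "collatz x = (if even x then x div 2 else (3 * x + 1) div 2)"

definition parity_vector :: "nat \<Rightarrow> int \<Rightarrow> nat list" where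
  "parity_vector L x = map (\<lambda>s. if odd ((collatz ^^ s) x) then 1 else 0) [0..<L]"

definition residue_of :: "nat \<Rightarrow> nat list \<Rightarrow> int" where
  "residue_of n as = (THE a. a \<in> {1..2 ^ sigma n - 1} \<and>
     {s. s < sigma n \<and> parity_vector (sigma n) a ! s = 1} = set as)"

definition residues_of_order :: "nat \<Rightarrow> int set" where
  "residues_of_order n = residue_of n ` admissible n"

definition coverage_set :: "nat \<Rightarrow> int set" where
  "coverage_set N = {x. x \<ge> 2 \<and>
     ([x = 0] (mod 2) \<or> [x = 1] (mod 4) \<or>
      (\<exists>n\<in>{1..N}. \<exists>a\<in>residues_of_order n. [x = a] (mod 2 ^ sigma n)))}"

(* If the coverage set is not all of {2..}, the set under Max is bounded by any
   missed integer, and it contains 2, so Max is a genuine maximum. *)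
definition coverage_bound :: "nat \<Rightarrow> enat" where
  "coverage_bound N =
     (if coverage_set N = {2..} then \<infinity>
      else enat (nat (Max {K. K \<ge> 2 \<and> {2..K} \<subseteq> coverage_set N})))"

definition least_missed :: "nat \<Rightarrow> int" where
  "least_missed N = (LEAST x. x \<ge> 2 \<and> x \<notin> coverage_set N)"

end

theory Submission
  imports Defs
begin

text \<open>
  Every congruence in the definition of the coverage set of order \<open>N\<close> has a modulus that is a
  power of two dividing \<open>2 ^ sigma N\<close>: the function \<open>sigma\<close> is increasing, and \<open>sigma N \<ge> 2\<close>
  because \<open>log 2 3 \<ge> 1\<close>.  Hence membership of an integer \<open>x \<ge> 2\<close> depends only on \<open>x\<close> modulo
  \<open>2 ^ sigma N\<close> (\<open>coverage_set_periodic\<close>).  Since \<open>{2..2 ^ sigma N + 1}\<close> is a complete residue system, any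
  missed integer has a missed representative there, which bounds the least missed integer.
  The coverage bound is its predecessor by minimality; here it matters that \<open>2\<close> is covered, so
  that the predecessor is at least \<open>2\<close>.
\<close>

lemma sigma_mono: "m \<le> n \<Longrightarrow> sigma m \<le> sigma n"
  unfolding sigma_def by (intro nat_mono floor_mono add_left_mono mult_right_mono) auto

lemma sigma_ge_2: "sigma n \<ge> 2"
proof -
  have "1 \<le> log 2 (3::real)"
    by simp
  then have "1 * 1 \<le> real (n + 1) * log 2 3"
    by (intro mult_mono) auto
  then have "2 \<le> \<lfloor>1 + real (n + 1) * log 2 3\<rfloor>"
    by (simp add: le_floor_iff)
  then show ?thesis
    unfolding sigma_def by linarith
qed

text \<open>
  Congruence modulo \<open>2 ^ sigma N\<close> refines congruence modulo \<open>2\<close>, \<open>4\<close> and each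
  \<open>2 ^ sigma n\<close> with \<open>n \<le> N\<close>, so it preserves each of the conditions that make an integer covered.
\<close>
lemma coverage_set_periodic:
  assumes "x \<ge> 2" "y \<ge> 2" and cong: "[x = y] (mod 2 ^ sigma N)"
  shows "x \<in> coverage_set N \<longleftrightarrow> y \<in> coverage_set N"
proof -
  have transfer: "[x = a] (mod 2 ^ k) \<longleftrightarrow> [y = a] (mod 2 ^ k)" if "k \<le> sigma N" for a k
  proof -
    have "[x = y] (mod 2 ^ k)"
      using cong le_imp_power_dvd[OF that] by (rule cong_dvd_modulus)
    then show ?thesis
      using cong_sym cong_trans by blast
  qed
  have "[x = 0] (mod 2) \<longleftrightarrow> [y = 0] (mod 2)"
    using transfer[of 1 0] sigma_ge_2[of N] by simp
  moreover have "[x = 1] (mod 4) \<longleftrightarrow> [y = 1] (mod 4)"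
    using transfer[of 2 1] sigma_ge_2[of N] by simp
  moreover have "[x = a] (mod 2 ^ sigma n) \<longleftrightarrow> [y = a] (mod 2 ^ sigma n)"
    if "n \<in> {1..N}" for a n
    using that by (intro transfer sigma_mono) simp
  ultimately show ?thesis
    using assms(1,2) unfolding coverage_set_def by auto
qed

lemma ex1_cong_in_interval:
  fixes a m x :: int
  assumes "m > 0"
  shows "\<exists>!y. y \<in> {a..a + m - 1} \<and> [y = x] (mod m)"
proof (rule ex1I)
  have "0 \<le> (x - a) mod m" "(x - a) mod m < m"
    using assms by simp_all
  moreover have "[a + (x - a) mod m = x] (mod m)"
    by (simp add: cong_def mod_add_right_eq)
  ultimately show "a + (x - a) mod m \<in> {a..a + m - 1} \<and> [a + (x - a) mod m = x] (mod m)"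
    by auto
next
  fix y
  assume y: "y \<in> {a..a + m - 1} \<and> [y = x] (mod m)"
  then have "(y - a) mod m = (x - a) mod m"
    unfolding cong_def by (intro mod_diff_cong) simp_all
  moreover have "(y - a) mod m = y - a"
    using y by (intro mod_pos_pos_trivial) auto
  ultimately show "y = a + (x - a) mod m"
    by simp
qed

text \<open>
  The operator \<open>LEAST\<close> on the integers is meaningful only if a minimum exists.  Here it does,
  because counting upwards from \<open>2\<close> transfers the well-ordering of the natural numbers.
\<close>
lemma least_missed_props:
  assumes "coverage_set N \<noteq> {2..}"
  shows "least_missed N \<ge> 2"
    and "least_missed N \<notin> coverage_set N"
    and "\<And>x. x \<ge> 2 \<Longrightarrow> x \<notin> coverage_set N \<Longrightarrow> least_missed N \<le> x"
proof -
  define k where "k = (LEAST k. 2 + int k \<notin> coverage_set N)"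
  have "coverage_set N \<subseteq> {2..}"
    unfolding coverage_set_def by auto
  then obtain z where z: "z \<ge> 2" "z \<notin> coverage_set N"
    using assms by auto
  have missed: "2 + int k \<notin> coverage_set N"
    unfolding k_def by (rule LeastI[of _ "nat (z - 2)"]) (use z in simp)
  have least: "2 + int k \<le> x" if "x \<ge> 2" "x \<notin> coverage_set N" for x
  proof -
    have "k \<le> nat (x - 2)"
      unfolding k_def by (rule Least_le) (use that in simp)
    then show ?thesis
      using that by linarith
  qed
  have eq: "least_missed N = 2 + int k"
    unfolding least_missed_def by (rule Least_equality) (use missed least in auto)
  show "least_missed N \<ge> 2" and "least_missed N \<notin> coverage_set N"
    using eq missed by simp_all
  show "\<And>x. x \<ge> 2 \<Longrightarrow> x \<notin> coverage_set N \<Longrightarrow> least_missed N \<le> x"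
    using eq least by simp
qed

lemma coverage_bound_eq:
  assumes "coverage_set N \<noteq> {2..}"
  shows "coverage_bound N = enat (nat (least_missed N - 1))"
proof -
  let ?m = "least_missed N"
  note m = least_missed_props[OF assms]
  have "2 \<in> coverage_set N"
    unfolding coverage_set_def by (simp add: cong_def)
  then have "?m \<ge> 3"
    using m(1,2) by (cases "?m = 2") auto
  moreover have "{K. K \<ge> 2 \<and> {2..K} \<subseteq> coverage_set N} = {2..?m - 1}"
  proof (intro set_eqI iffI)
    fix K
    assume K: "K \<in> {K. K \<ge> 2 \<and> {2..K} \<subseteq> coverage_set N}"
    then have "?m \<notin> {2..K}"
      using m(2) by auto
    then show "K \<in> {2..?m - 1}"
      using K m(1) by auto
  next
    fix K
    assume K: "K \<in> {2..?m - 1}"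
    have "x \<in> coverage_set N" if "x \<in> {2..K}" for x
      using m(3)[of x] that K by force
    then show "K \<in> {K. K \<ge> 2 \<and> {2..K} \<subseteq> coverage_set N}"
      using K by auto
  qed
  moreover have "Max {2..?m - 1} = ?m - 1" if "?m \<ge> 3"
    using that by (intro Max_eqI) auto
  ultimately show ?thesis
    using assms unfolding coverage_bound_def by simp
qed

theorem corollary25:
  fixes N :: nat
  assumes "N \<ge> 1"
    and "coverage_set N \<noteq> {2..}"
  shows "least_missed N \<le> 2 ^ sigma N + 1 \<and>
    coverage_bound N = enat (nat (least_missed N - 1)) \<and>
    (\<forall>x\<ge>2.
      (\<exists>!y. y \<in> {2..2 ^ sigma N + 1} \<and> [y = x] (mod 2 ^ sigma N)) \<and>
      (x \<in> coverage_set N \<longleftrightarrow>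
        (THE y. y \<in> {2..2 ^ sigma N + 1} \<and> [y = x] (mod 2 ^ sigma N)) \<in> coverage_set N))"
proof -
  let ?P = "\<lambda>x y. y \<in> {2..2 ^ sigma N + 1} \<and> [y = x] (mod 2 ^ sigma N)"
  note m = least_missed_props[OF assms(2)]
  have ex1: "\<exists>!y. ?P x y" for x :: int
    using ex1_cong_in_interval[of "2 ^ sigma N" 2 x] by (simp add: add.commute)
  have covered_iff: "x \<in> coverage_set N \<longleftrightarrow> y \<in> coverage_set N" if "x \<ge> 2" "?P x y" for x y
    using that by (intro coverage_set_periodic) (auto intro: cong_sym)
  have "least_missed N \<le> 2 ^ sigma N + 1"
  proof -
    obtain y where y: "?P (least_missed N) y"
      using ex1 by blast
    then have "y \<notin> coverage_set N"
      using covered_iff[OF m(1) y] m(2) by simp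
    then show ?thesis
      using m(3)[of y] y by auto
  qed
  moreover have "x \<in> coverage_set N \<longleftrightarrow> (THE y. ?P x y) \<in> coverage_set N" if "x \<ge> 2" for x
    using covered_iff[OF that theI'[OF ex1[of x]]] .
  ultimately show ?thesis
    using coverage_bound_eq[OF assms(2)] ex1 by blast
qed

end
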